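(* Let $\mathbb X$ be a countable ultrahomogeneous $L$-structure (for a relational language $L$) and $A\subseteq X$. Then $A\in\mathbb P(\mathbb X)$ if and only if for every finite $F\subseteq A$ and every $x\in X\setminus F$ we have $\mathrm{orb}_F(x)\cap A\neq\emptyset$. Consequently, if $A$ intersects all orbits of $\mathbb X$, then $A\in\mathbb P(\mathbb X)$.
   Context: $\mathbb X$ is ultrahomogeneous iff every isomorphism between finite substructures extends to an automorphism of $\mathbb X$. $\mathbb P(\mathbb X)$ is the set of $A\subseteq X$ such that the induced substructure on $A$ is isomorphic to $\mathbb X$. For finite $F\subseteq X$ and $x\in X\setminus F$, $\mathrm{orb}_F(x)=\{y\in X\setminus F:\exists g\in\mathrm{Aut}(\mathbb X)\,(g\restriction F=\mathrm{id}_F\wedge g(x)=y)\}$; the orbits of $\mathbb X$ are all sets $\mathrm{orb}_F(x)$ with $F$ finite and $x\in X\setminus F$. *)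

theory Defs
  imports Main "HOL-Library.Countable_Set"
begin

record 'r rel_language =
  symbols :: "'r set"
  arity :: "'r \<Rightarrow> nat"

text \<open>Tuples are represented as lists. Interpretations of names outside the language are
  irrelevant, and so are the values of maps outside the universe of their domain.\<close>

record ('r, 'a) rel_struct =
  universe :: "'a set"
  interp :: "'r \<Rightarrow> 'a list set"

definition is_struct :: "'r rel_language \<Rightarrow> ('r, 'a) rel_struct \<Rightarrow> bool" where
  "is_struct L M \<longleftrightarrow>
     (\<forall>R\<in>symbols L. interp M R \<subseteq> {xs \<in> lists (universe M). length xs = arity L R})"

definition induced :: "('r, 'a) rel_struct \<Rightarrow> 'a set \<Rightarrow> ('r, 'a) rel_struct" where
  "induced M A = \<lparr>universe = A, interp = (\<lambda>R. interp M R \<inter> lists A)\<rparr>"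

definition is_iso ::
  "'r rel_language \<Rightarrow> ('r, 'a) rel_struct \<Rightarrow> ('r, 'b) rel_struct \<Rightarrow> ('a \<Rightarrow> 'b) \<Rightarrow> bool" where
  "is_iso L M N f \<longleftrightarrow> bij_betw f (universe M) (universe N) \<and>
     (\<forall>R\<in>symbols L. \<forall>xs\<in>lists (universe M). length xs = arity L R \<longrightarrow>
        (xs \<in> interp M R \<longleftrightarrow> map f xs \<in> interp N R))"

definition isomorphic ::
  "'r rel_language \<Rightarrow> ('r, 'a) rel_struct \<Rightarrow> ('r, 'b) rel_struct \<Rightarrow> bool" where
  "isomorphic L M N \<longleftrightarrow> (\<exists>f. is_iso L M N f)"

definition automorphisms :: "'r rel_language \<Rightarrow> ('r, 'a) rel_struct \<Rightarrow> ('a \<Rightarrow> 'a) set" where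
  "automorphisms L M = {g. is_iso L M M g}"

definition ultrahomogeneous :: "'r rel_language \<Rightarrow> ('r, 'a) rel_struct \<Rightarrow> bool" where
  "ultrahomogeneous L M \<longleftrightarrow>
     (\<forall>F G f. finite F \<and> F \<subseteq> universe M \<and> finite G \<and> G \<subseteq> universe M \<and>
        is_iso L (induced M F) (induced M G) f \<longrightarrow>
        (\<exists>g\<in>automorphisms L M. \<forall>x\<in>F. g x = f x))"

definition copies :: "'r rel_language \<Rightarrow> ('r, 'a) rel_struct \<Rightarrow> 'a set set" where
  "copies L M = {A. A \<subseteq> universe M \<and> isomorphic L (induced M A) M}"

definition orb :: "'r rel_language \<Rightarrow> ('r, 'a) rel_struct \<Rightarrow> 'a set \<Rightarrow> 'a \<Rightarrow> 'a set" where
  "orb L M F x =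
     {y \<in> universe M - F. \<exists>g\<in>automorphisms L M. (\<forall>z\<in>F. g z = z) \<and> g x = y}"

definition orbits :: "'r rel_language \<Rightarrow> ('r, 'a) rel_struct \<Rightarrow> 'a set set" where
  "orbits L M = {orb L M F x | F x. finite F \<and> F \<subseteq> universe M \<and> x \<in> universe M - F}"

end

theory Submission
  imports Defs
begin

text \<open>For the forward direction, compose the inverse of an isomorphism $f : A \to X$ with an
  automorphism extending $f \restriction F$: this embeds $X$ into $A$ over $F$, and by
  ultrahomogeneity the image of $x$ lies in its orbit over $F$. For the converse, approximate an
  isomorphism $X \to A$ by pairs $(F, g)$ of a finite set $F$ and an automorphism $g$ mapping $F$
  into $A$. In the forth step the orbit of $g(x)$ over $g[F]$ meets $A$, so $g$ can be corrected to
  map $x$ into $A$; the back step only enlarges $F$ by a preimage under $g$.\<close>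

lemma universe_induced [simp]: "universe (induced M A) = A"
  by (simp add: induced_def)

lemma interp_induced [simp]: "interp (induced M A) R = interp M R \<inter> lists A"
  by (simp add: induced_def)

lemma is_iso_bij_betw: "is_iso L M N f \<Longrightarrow> bij_betw f (universe M) (universe N)"
  by (simp add: is_iso_def)

lemma is_iso_interp_iff:
  assumes "is_iso L M N f" "R \<in> symbols L" "set xs \<subseteq> universe M" "length xs = arity L R"
  shows "map f xs \<in> interp N R \<longleftrightarrow> xs \<in> interp M R"
  using assms by (auto simp: is_iso_def in_lists_conv_set subset_iff)

lemma is_isoI:
  assumes "bij_betw f (universe M) (universe N)"
    and "\<And>R xs. R \<in> symbols L \<Longrightarrow> set xs \<subseteq> universe M \<Longrightarrow> length xs = arity L R \<Longrightarrow>
           map f xs \<in> interp N R \<longleftrightarrow> xs \<in> interp M R"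
  shows "is_iso L M N f"
  using assms by (auto simp: is_iso_def in_lists_conv_set subset_iff)

lemma is_iso_id: "is_iso L M M id"
  by (rule is_isoI) auto

lemma is_iso_comp:
  assumes f: "is_iso L M N f" and g: "is_iso L N K g"
  shows "is_iso L M K (g \<circ> f)"
proof (rule is_isoI)
  show "bij_betw (g \<circ> f) (universe M) (universe K)"
    using f g by (blast intro: bij_betw_trans is_iso_bij_betw)
next
  fix R xs
  assume R: "R \<in> symbols L" and xs: "set xs \<subseteq> universe M" "length xs = arity L R"
  have "set (map f xs) \<subseteq> universe N"
    using is_iso_bij_betw[OF f] xs(1) by (auto simp: bij_betw_def)
  then show "map (g \<circ> f) xs \<in> interp K R \<longleftrightarrow> xs \<in> interp M R"
    using is_iso_interp_iff[OF g R, of "map f xs"] is_iso_interp_iff[OF f R xs] xs(2) by simp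
qed

lemma is_iso_inv_into:
  assumes f: "is_iso L M N f"
  shows "is_iso L N M (inv_into (universe M) f)"
proof (rule is_isoI)
  let ?i = "inv_into (universe M) f"
  show bij: "bij_betw ?i (universe N) (universe M)"
    by (rule bij_betw_inv_into[OF is_iso_bij_betw[OF f]])
  fix R ys
  assume R: "R \<in> symbols L" and ys: "set ys \<subseteq> universe N" "length ys = arity L R"
  have "set (map ?i ys) \<subseteq> universe M"
    using bij ys(1) by (auto simp: bij_betw_def)
  moreover have "map f (map ?i ys) = ys"
    using ys(1) bij_betw_inv_into_right[OF is_iso_bij_betw[OF f]]
    by (auto simp: subset_iff intro: map_idI)
  ultimately show "map ?i ys \<in> interp M R \<longleftrightarrow> ys \<in> interp N R"
    using is_iso_interp_iff[OF f R, of "map ?i ys"] ys(2) by simp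
qed

lemma is_iso_restrict:
  assumes f: "is_iso L M N f" and F: "F \<subseteq> universe M"
  shows "is_iso L (induced M F) (induced N (f ` F)) f"
proof (rule is_isoI)
  show "bij_betw f (universe (induced M F)) (universe (induced N (f ` F)))"
    using bij_betw_subset[OF is_iso_bij_betw[OF f] F] by simp
  fix R xs
  assume "R \<in> symbols L" "set xs \<subseteq> universe (induced M F)" "length xs = arity L R"
  then show "map f xs \<in> interp (induced N (f ` F)) R \<longleftrightarrow> xs \<in> interp (induced M F) R"
    using is_iso_interp_iff[OF f] F by (auto simp: in_lists_conv_set subset_iff)
qed

text \<open>Turns restrictions of maps into or out of \<open>induced M A\<close> into isomorphisms
  between substructures of \<open>M\<close> itself, the form in which ultrahomogeneity
  applies.\<close>

lemma induced_induced: "B \<subseteq> A \<Longrightarrow> induced (induced M A) B = induced M B"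
  by (auto simp: induced_def fun_eq_iff in_lists_conv_set)

lemma orb_meets_copy:
  assumes uh: "ultrahomogeneous L M"
    and A: "A \<in> copies L M"
    and F: "finite F" "F \<subseteq> A"
    and x: "x \<in> universe M - F"
  shows "orb L M F x \<inter> A \<noteq> {}"
proof -
  have AM: "A \<subseteq> universe M" using A by (simp add: copies_def)
  obtain f where f: "is_iso L (induced M A) M f"
    using A by (auto simp: copies_def isomorphic_def)
  have bij_f: "bij_betw f A (universe M)" using is_iso_bij_betw[OF f] by simp
  have "is_iso L (induced M F) (induced M (f ` F)) f"
    using is_iso_restrict[OF f, of F] F(2) by (simp add: induced_induced)
  moreover have "f ` F \<subseteq> universe M" using bij_f F(2) by (auto simp: bij_betw_def)
  ultimately obtain g where g: "is_iso L M M g" "\<forall>z\<in>F. g z = f z"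
    using uh F AM unfolding ultrahomogeneous_def automorphisms_def
    by (metis finite_imageI mem_Collect_eq subset_trans)
  define k where "k = inv_into A f \<circ> g"
  have k: "is_iso L M (induced M A) k"
    unfolding k_def using is_iso_comp[OF g(1) is_iso_inv_into[OF f]] by simp
  have kF: "k z = z" if "z \<in> F" for z
    using that g(2) F(2) bij_betw_inv_into_left[OF bij_f] by (auto simp: k_def)
  have kA: "k ` insert x F \<subseteq> A"
  proof -
    have "k ` insert x F \<subseteq> k ` universe M" using x F(2) AM by (intro image_mono) auto
    then show ?thesis using is_iso_bij_betw[OF k] by (simp add: bij_betw_imp_surj_on)
  qed
  \<comment> \<open>Orbits over \<open>F\<close> avoid \<open>F\<close> by definition. A value
    \<open>k x\<close> in \<open>F\<close> would be fixed by \<open>k\<close>, and injectivity of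
    \<open>k\<close> would force \<open>k x = x\<close>.\<close>
  have kx: "k x \<notin> F"
  proof
    assume "k x \<in> F"
    then have "k (k x) = k x" by (rule kF)
    moreover have "k x \<in> universe M" using kA AM by auto
    ultimately have "k x = x"
      using is_iso_bij_betw[OF k] x by (auto simp: bij_betw_def dest: inj_onD)
    then show False using \<open>k x \<in> F\<close> x by simp
  qed
  \<comment> \<open>\<open>k\<close> has range \<open>A\<close>, so it need not be an automorphism.
    Its restriction to the finite set \<open>insert x F\<close> extends to one, and that extension
    witnesses \<open>k x\<close> in the orbit of \<open>x\<close>.\<close>
  have "is_iso L (induced M (insert x F)) (induced M (k ` insert x F)) k"
    using is_iso_restrict[OF k, of "insert x F"] x F(2) AM kA by (simp add: induced_induced)
  moreover have "insert x F \<subseteq> universe M" "k ` insert x F \<subseteq> universe M"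
    using x F(2) AM kA by auto
  ultimately obtain h where h: "h \<in> automorphisms L M" "\<forall>z\<in>insert x F. h z = k z"
    using uh F(1) unfolding ultrahomogeneous_def by (metis finite_imageI finite_insert)
  have "k x \<in> orb L M F x"
    unfolding orb_def using h kF kx kA AM by auto
  then show ?thesis using kA by auto
qed

text \<open>Carrying a total automorphism rather than a finite partial map makes preimages available
  at once: surjectivity settles the back step, and only the forth step appeals to the orbit
  hypothesis.\<close>

lemma back_and_forth_step:
  assumes orb: "\<forall>F x. finite F \<and> F \<subseteq> A \<and> x \<in> universe M - F \<longrightarrow> orb L M F x \<inter> A \<noteq> {}"
    and g: "is_iso L M M g" and F: "finite F" "F \<subseteq> universe M" "g ` F \<subseteq> A"
    and x: "x \<in> universe M"
  obtains F' g' where "is_iso L M M g'" "finite F'" "F' \<subseteq> universe M" "g' ` F' \<subseteq> A"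
    "F \<subseteq> F'" "\<forall>z\<in>F. g' z = g z" "x \<in> F'" "x \<in> A \<longrightarrow> x \<in> g' ` F'"
proof -
  obtain g' where g': "is_iso L M M g'" "\<forall>z\<in>F. g' z = g z" "g' x \<in> A"
  proof (cases "g x \<in> A")
    case True
    then show ?thesis using g that by blast
  next
    case False
    \<comment> \<open>Since \<open>g\<close>
      F\<open>lies inside\<close>A\<open>, a point outside\<close>A\<open>is also outside\<close>g
      \<open>F\<close>, so the orbit hypothesis applies to it.\<close>
    then have "g x \<in> universe M - g ` F"
      using x F(3) is_iso_bij_betw[OF g] by (auto simp: bij_betw_def)
    then have "orb L M (g ` F) (g x) \<inter> A \<noteq> {}" using F orb by simp
    then obtain h where "is_iso L M M h" "\<forall>z\<in>g ` F. h z = z" "h (g x) \<in> A"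
      by (auto simp: orb_def automorphisms_def)
    then show ?thesis using is_iso_comp[OF g, of M h] by (intro that[of "h \<circ> g"]) auto
  qed
  obtain w where w: "w \<in> universe M" "g' w = x"
    using x is_iso_bij_betw[OF g'(1)] by (metis bij_betw_imp_surj_on imageE)
  show ?thesis
  \<comment> \<open>The preimage \<open>w\<close> is added only when \<open>x\<close> is in
    \<open>A\<close>, because its image \<open>x\<close> has to lie in \<open>A\<close>.\<close>
  proof (rule that[of g' "insert x F \<union> {v. v = w \<and> x \<in> A}"])
    show "g' ` (insert x F \<union> {v. v = w \<and> x \<in> A}) \<subseteq> A"
      using g'(2,3) F(3) w(2) by auto
  qed (use g' F x w in auto)
qed

text \<open>Countability lets a sequence of steps treat every point. The limit map is an isomorphism
  onto \<open>A\<close> because injectivity and preservation of relations concern finitely many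
  points at a time, and there it agrees with an automorphism.\<close>

lemma copy_if_orbs_meet:
  assumes cnt: "countable (universe M)" and AM: "A \<subseteq> universe M"
    and orb: "\<forall>F x. finite F \<and> F \<subseteq> A \<and> x \<in> universe M - F \<longrightarrow> orb L M F x \<inter> A \<noteq> {}"
  shows "A \<in> copies L M"
proof (cases "universe M = {}")
  \<comment> \<open>The empty universe is split off because it has no enumeration by natural
    numbers.\<close>
  case True
  then have "is_iso L (induced M A) M id"
    using AM by (intro is_isoI) simp_all
  then show ?thesis using AM by (auto simp: copies_def isomorphic_def)
next
  case False
  define e where "e = from_nat_into (universe M)"
  have e_in: "e n \<in> universe M" for n
    unfolding e_def using False by (rule from_nat_into)
  have e_surj: "\<exists>n. e n = z" if "z \<in> universe M" for z
    unfolding e_def using from_nat_into_surj[OF cnt that] .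
  \<comment> \<open>\<open>?P\<close> is the invariant of one pair. \<open>?Q\<close> says that the
    next pair extends it and handles \<open>e n\<close> as an argument and, if it lies in
    \<open>A\<close>, also as a value.\<close>
  let ?P = "\<lambda>s. is_iso L M M (snd s) \<and> finite (fst s) \<and> fst s \<subseteq> universe M \<and> snd s ` fst s \<subseteq> A"
  let ?Q = "\<lambda>n s t. fst s \<subseteq> fst t \<and> (\<forall>z\<in>fst s. snd t z = snd s z) \<and> e n \<in> fst t \<and>
              (e n \<in> A \<longrightarrow> e n \<in> snd t ` fst t)"
  have "\<exists>s. \<forall>n. ?P (s n) \<and> ?Q n (s n) (s (Suc n))"
  proof (rule dependent_nat_choice)
    show "\<exists>s. ?P s" by (rule exI[of _ "({}, id)"]) (simp add: is_iso_id)
    fix s n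
    assume "?P s"
    then have "is_iso L M M (snd s)" "finite (fst s)" "fst s \<subseteq> universe M" "snd s ` fst s \<subseteq> A"
      by simp_all
    from back_and_forth_step[OF orb this e_in[of n]]
    obtain F' g' where "is_iso L M M g'" "finite F'" "F' \<subseteq> universe M" "g' ` F' \<subseteq> A"
      "fst s \<subseteq> F'" "\<forall>z\<in>fst s. g' z = snd s z" "e n \<in> F'" "e n \<in> A \<longrightarrow> e n \<in> g' ` F'" .
    then show "\<exists>t. ?P t \<and> ?Q n s t" by (intro exI[of _ "(F', g')"]) simp
  qed
  then obtain s where s: "\<forall>n. ?P (s n) \<and> ?Q n (s n) (s (Suc n))" ..
  define F where "F = (\<lambda>n. fst (s n))"
  define g where "g = (\<lambda>n. snd (s n))"
  have F_Suc: "F n \<subseteq> F (Suc n)" and g_Suc: "\<forall>z\<in>F n. g (Suc n) z = g n z"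
    and e_F: "e n \<in> F (Suc n)" and e_gF: "e n \<in> A \<longrightarrow> e n \<in> g (Suc n) ` F (Suc n)" for n
    using spec[OF s, of n] by (simp_all add: F_def g_def)
  have iso_g: "is_iso L M M (g n)" and FM: "F n \<subseteq> universe M" and gF: "g n ` F n \<subseteq> A" for n
    using spec[OF s, of n] by (simp_all add: F_def g_def)
  have chain: "F m \<subseteq> F n \<and> (\<forall>z\<in>F m. g n z = g m z)" if "m \<le> n" for m n
    using that
  proof (induction rule: dec_induct)
    case (step n)
    then show ?case using F_Suc[of n] g_Suc[of n] by (simp add: subset_iff)
  qed simp
  have cover: "\<exists>n. z \<in> F n" if "z \<in> universe M" for z
    using e_surj[OF that] e_F by blast
  \<comment> \<open>The sets \<open>F n\<close> increase, so a finite tuple already lies in a single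
    one of them.\<close>
  have covers: "\<exists>n. set xs \<subseteq> F n" if "set xs \<subseteq> universe M" for xs
    using that
  proof (induction xs)
    case (Cons z xs)
    then obtain m where "set xs \<subseteq> F m" by auto
    moreover obtain n where "z \<in> F n" using cover[of z] Cons.prems by auto
    ultimately have "set (z # xs) \<subseteq> F (max m n)"
      using chain[of m "max m n"] chain[of n "max m n"] by auto
    then show ?case ..
  qed simp
  \<comment> \<open>The least index is a mere choice: by \<open>chain\<close>, every stage whose
    domain contains \<open>z\<close> gives the same value.\<close>
  define f where "f z = g (LEAST n. z \<in> F n) z" for z
  have f_eq: "f z = g n z" if "z \<in> F n" for z n
  proof -
    have "(LEAST n. z \<in> F n) \<le> n" "z \<in> F (LEAST n. z \<in> F n)"
      using Least_le[of "\<lambda>n. z \<in> F n", OF that] LeastI[of "\<lambda>n. z \<in> F n", OF that] .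
    then show ?thesis using chain[of "LEAST n. z \<in> F n" n] by (simp add: f_def)
  qed
  have "is_iso L M (induced M A) f"
  proof (rule is_isoI)
    have "inj_on f (universe M)"
    proof (rule inj_onI)
      fix y z
      assume yz: "y \<in> universe M" "z \<in> universe M" "f y = f z"
      then obtain n where "y \<in> F n" "z \<in> F n" using covers[of "[y, z]"] by auto
      then have "g n y = g n z" using f_eq[of y n] f_eq[of z n] yz(3) by simp
      then show "y = z"
        using is_iso_bij_betw[OF iso_g] yz(1,2) by (auto simp: bij_betw_def dest: inj_onD)
    qed
    moreover have "f ` universe M \<subseteq> A"
    proof
      fix y
      assume "y \<in> f ` universe M"
      then obtain z n where "y = f z" "z \<in> F n" using cover by blast
      then show "y \<in> A" using f_eq[of z n] gF[of n] by auto
    qed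
    moreover have "A \<subseteq> f ` universe M"
    proof
      fix a
      assume a: "a \<in> A"
      then obtain n where "e n = a" using e_surj AM by blast
      then have "a \<in> g (Suc n) ` F (Suc n)" using e_gF[of n] a by simp
      then obtain z where "z \<in> F (Suc n)" "a = g (Suc n) z" by blast
      then have "a = f z" "z \<in> universe M"
        using f_eq[of z "Suc n"] FM[of "Suc n"] by auto
      then show "a \<in> f ` universe M" by (rule image_eqI)
    qed
    ultimately show "bij_betw f (universe M) (universe (induced M A))"
      by (auto simp: bij_betw_def)
    then have fA: "f ` universe M = A" by (simp add: bij_betw_def)
    fix R xs
    assume R: "R \<in> symbols L" and xs: "set xs \<subseteq> universe M" "length xs = arity L R"
    \<comment> \<open>On the entries of one tuple \<open>f\<close> coincides with the automorphism
      \<open>g n\<close>, which preserves and reflects \<open>R\<close>.\<close>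
    obtain n where "set xs \<subseteq> F n" using covers[OF xs(1)] by blast
    then have "map f xs = map (g n) xs" using f_eq[of _ n] by (auto simp: subset_iff)
    then have "map f xs \<in> interp M R \<longleftrightarrow> xs \<in> interp M R"
      using is_iso_interp_iff[OF iso_g R xs] by (simp only:)
    moreover have "map f xs \<in> lists A"
      using xs(1) fA by (auto simp: in_lists_conv_set)
    ultimately show "map f xs \<in> interp (induced M A) R \<longleftrightarrow> xs \<in> interp M R" by simp
  qed
  \<comment> \<open>The construction runs from \<open>M\<close> to \<open>A\<close>, whereas
    \<open>copies\<close> asks for a map from \<open>A\<close> to \<open>M\<close>.\<close>
  then have "is_iso L (induced M A) M (inv_into (universe M) f)" by (rule is_iso_inv_into)
  then show ?thesis using AM by (auto simp: copies_def isomorphic_def)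
qed

theorem theorem2p3:
  fixes L :: "'r rel_language"
    and M :: "('r, 'a) rel_struct"
    and A :: "'a set"
  assumes "is_struct L M"
    and "countable (universe M)"
    and "ultrahomogeneous L M"
    and "A \<subseteq> universe M"
  shows "(A \<in> copies L M \<longleftrightarrow>
            (\<forall>F x. finite F \<and> F \<subseteq> A \<and> x \<in> universe M - F \<longrightarrow> orb L M F x \<inter> A \<noteq> {}))
       \<and> ((\<forall>B\<in>orbits L M. B \<inter> A \<noteq> {}) \<longrightarrow> A \<in> copies L M)"
proof (intro conjI iffI impI)
  show "\<forall>F x. finite F \<and> F \<subseteq> A \<and> x \<in> universe M - F \<longrightarrow> orb L M F x \<inter> A \<noteq> {}"
    if "A \<in> copies L M"
    using orb_meets_copy[OF assms(3) that] by blast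
  show "A \<in> copies L M"
    if "\<forall>F x. finite F \<and> F \<subseteq> A \<and> x \<in> universe M - F \<longrightarrow> orb L M F x \<inter> A \<noteq> {}"
    using copy_if_orbs_meet[OF assms(2,4) that] .
  show "A \<in> copies L M" if meets: "\<forall>B\<in>orbits L M. B \<inter> A \<noteq> {}"
  proof (intro copy_if_orbs_meet[OF assms(2,4)] allI impI)
    fix F x
    assume "finite F \<and> F \<subseteq> A \<and> x \<in> universe M - F"
    then have "orb L M F x \<in> orbits L M"
      using assms(4) unfolding orbits_def by blast
    then show "orb L M F x \<inter> A \<noteq> {}" using meets by blast
  qed
qed

end
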